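(* Let $R=\mathbb{C}[x_1,\ldots,x_d]$. For each ideal $I$ of $R$ the ideal $I^{(\circ)}$ is power-closed, and the operation $I\mapsto I^{(\circ)}$ is an interior operator: (i) $I\supseteq I^{(\circ)}$ for each ideal $I$ of $R$; (ii) $I\supseteq J$ implies $I^{(\circ)}\supseteq J^{(\circ)}$ for ideals $I,J$ of $R$; (iii) $(I^{(\circ)})^{(\circ)}=I^{(\circ)}$ for each ideal $I$ of $R$; (iv) the operator commutes with intersections of ideals, that is, $\left(\bigcap_{I\in\mathcal{I}}I\right)^{(\circ)}=\bigcap_{I\in\mathcal{I}}I^{(\circ)}$ for any family $\mathcal{I}$ of ideals of $R$.
   Context: For $f=f(x_1,\ldots,x_d)\in R$ and $i\in\mathbb{N}=\{1,2,\ldots\}$, put $f^{(i)}=f(x_1^i,\ldots,x_d^i)$. An ideal $I$ of $R$ is power-closed if $f\in I$ implies $f^{(i)}\in I$ for every $i\in\mathbb{N}$. For an ideal $I$ of $R$, its power-interior is $I^{(\circ)}=\sum_J J$, the sum of all power-closed ideals $J$ of $R$ with $J\subseteq I$. *)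

theory Defs
  imports "HOL-Library.Poly_Mapping" "HOL-Algebra.Algebraic_Closure_Type"
begin

text \<open>
  Complex polynomials whose variables are indexed by the finite type \<open>'d\<close>, so that
  \<open>'d cpoly\<close> is the ring of complex polynomials in \<open>d = CARD('d)\<close> variables. A monomial is
  its exponent vector \<open>'d \<Rightarrow>\<^sub>0 nat\<close>, and the product inherited from
  \<^theory>\<open>HOL-Library.Poly_Mapping\<close> is the convolution product.
\<close>

type_synonym 'd cpoly = "('d \<Rightarrow>\<^sub>0 nat) \<Rightarrow>\<^sub>0 complex"

definition Const :: "complex \<Rightarrow> 'd cpoly" where
  "Const c = Poly_Mapping.single 0 c"

definition Var :: "'d \<Rightarrow> 'd cpoly" where
  "Var j = Poly_Mapping.single (Poly_Mapping.single j 1) 1"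

definition cpoly_subst :: "('d::finite \<Rightarrow> 'd cpoly) \<Rightarrow> 'd cpoly \<Rightarrow> 'd cpoly" where
  "cpoly_subst \<sigma> f =
     (\<Sum>m\<in>Poly_Mapping.keys f.
        Const (Poly_Mapping.lookup f m) * (\<Prod>j\<in>UNIV. \<sigma> j ^ Poly_Mapping.lookup m j))"

definition power_subst :: "nat \<Rightarrow> 'd::finite cpoly \<Rightarrow> 'd cpoly" where
  "power_subst i f = cpoly_subst (\<lambda>j. Var j ^ i) f"

text \<open>The ideals of \<open>'d cpoly\<close> are those of the ring with carrier \<open>UNIV\<close> in the sense of HOL-Algebra.\<close>

abbreviation is_ideal :: "'a::comm_ring_1 set \<Rightarrow> bool" where
  "is_ideal I \<equiv> ideal I ring_of_type_algebra"

definition power_closed :: "'d::finite cpoly set \<Rightarrow> bool" where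
  "power_closed I \<longleftrightarrow> (\<forall>f\<in>I. \<forall>i\<ge>1. power_subst i f \<in> I)"

text \<open>The sum of a possibly infinite family: all finite sums of elements of its members.\<close>

definition ideal_sum :: "'a::comm_ring_1 set set \<Rightarrow> 'a set" where
  "ideal_sum \<J> = {(\<Sum>J\<in>F. g J) | F g. finite F \<and> F \<subseteq> \<J> \<and> (\<forall>J\<in>F. g J \<in> J)}"

definition power_interior :: "'d::finite cpoly set \<Rightarrow> 'd cpoly set" where
  "power_interior I = ideal_sum {J. is_ideal J \<and> power_closed J \<and> J \<subseteq> I}"

end

theory Submission
  imports Defs
begin

text \<open>
  Everything follows from one fact: substituting powers for the variables is additive, so a sum
  of power-closed ideals is again a power-closed ideal. Hence the power-interior of an ideal
  \<open>I\<close> is not just a sum but the largest power-closed ideal inside \<open>I\<close>: a power-closed ideal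
  lies in \<open>I\<close> if and only if it lies in the power-interior (\<open>subset_power_interior_iff\<close>).

  Taking power-interiors is thus right adjoint to the inclusion of the power-closed ideals into all
  ideals, and the properties of an interior operator are formal consequences. Intersections
  are preserved because power-closed ideals are stable under arbitrary intersections; the empty
  intersection is the whole ring, which is a power-closed ideal.
\<close>

section \<open>Ideals and their sums\<close>

lemma is_ideal_iff:
  fixes I :: "'a::comm_ring_1 set"
  shows "is_ideal I \<longleftrightarrow>
    0 \<in> I \<and> (\<forall>a\<in>I. \<forall>b\<in>I. a + b \<in> I) \<and> (\<forall>a\<in>I. \<forall>r. r * a \<in> I)"
proof
  assume "is_ideal I"
  then interpret ideal I "ring_of_type_algebra :: 'a ring" .
  show "0 \<in> I \<and> (\<forall>a\<in>I. \<forall>b\<in>I. a + b \<in> I) \<and> (\<forall>a\<in>I. \<forall>r. r * a \<in> I)"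
    using additive_subgroup.zero_closed[OF is_additive_subgroup]
      additive_subgroup.a_closed[OF is_additive_subgroup] I_l_closed
    by (auto simp: ring_of_type_algebra_def)
next
  assume I: "0 \<in> I \<and> (\<forall>a\<in>I. \<forall>b\<in>I. a + b \<in> I) \<and> (\<forall>a\<in>I. \<forall>r. r * a \<in> I)"
  have minus: "- a \<in> I" if "a \<in> I" for a
    using I that by (metis mult_minus1)
  have grp: "group (add_monoid (ring_of_type_algebra :: 'a ring))"
    by (intro abelian_group.a_group ring.is_abelian_group ring_from_type_algebra)
  have inv: "inv\<^bsub>add_monoid ring_of_type_algebra\<^esub> a = - a" for a :: 'a
    by (rule group.inv_equality[OF grp]) (auto simp: ring_of_type_algebra_def)
  show "is_ideal I"
  proof (rule idealI)
    show "ring (ring_of_type_algebra :: 'a ring)"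
      by (rule ring_from_type_algebra)
    show "subgroup I (add_monoid ring_of_type_algebra)"
      by (rule subgroup.intro; (simp only: inv)?)
        (use I minus in \<open>auto simp: ring_of_type_algebra_def\<close>)
  qed (use I in \<open>auto simp: ring_of_type_algebra_def mult.commute\<close>)
qed

lemma is_ideal_Inter:
  assumes "\<And>I. I \<in> \<I> \<Longrightarrow> is_ideal I"
  shows "is_ideal (\<Inter>\<I>)"
  using assms unfolding is_ideal_iff by blast

lemma is_ideal_sum_closed:
  assumes "is_ideal I" and "\<And>x. x \<in> A \<Longrightarrow> g x \<in> I"
  shows "(\<Sum>x\<in>A. g x) \<in> I"
  using assms(2) by (induction A rule: infinite_finite_induct)
    (use assms(1) in \<open>auto simp: is_ideal_iff\<close>)

lemma ideal_sum_upper: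
  assumes "J \<in> \<J>"
  shows "J \<subseteq> ideal_sum \<J>"
proof
  fix a assume "a \<in> J"
  then show "a \<in> ideal_sum \<J>"
    unfolding ideal_sum_def using assms
    by (intro CollectI exI[of _ "{J}"] exI[of _ "\<lambda>_. a"]) auto
qed

lemma ideal_sum_least:
  assumes "is_ideal I" and "\<And>J. J \<in> \<J> \<Longrightarrow> J \<subseteq> I"
  shows "ideal_sum \<J> \<subseteq> I"
proof
  fix a assume "a \<in> ideal_sum \<J>"
  then obtain F g where F: "a = (\<Sum>J\<in>F. g J)" "F \<subseteq> \<J>" "\<forall>J\<in>F. g J \<in> J"
    unfolding ideal_sum_def by blast
  then show "a \<in> I"
    using assms by (auto intro!: is_ideal_sum_closed)
qed

lemma is_ideal_ideal_sum:
  fixes \<J> :: "'a::comm_ring_1 set set"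
  assumes ideals: "\<And>J. J \<in> \<J> \<Longrightarrow> is_ideal J"
  shows "is_ideal (ideal_sum \<J>)"
  unfolding is_ideal_iff
proof (intro conjI ballI allI)
  show "0 \<in> ideal_sum \<J>"
    unfolding ideal_sum_def by (intro CollectI exI[of _ "{}"]) simp
next
  fix a b assume "a \<in> ideal_sum \<J>" "b \<in> ideal_sum \<J>"
  then obtain F g G h
    where F: "a = (\<Sum>J\<in>F. g J)" "finite F" "F \<subseteq> \<J>" "\<forall>J\<in>F. g J \<in> J"
      and G: "b = (\<Sum>J\<in>G. h J)" "finite G" "G \<subseteq> \<J>" "\<forall>J\<in>G. h J \<in> J"
    unfolding ideal_sum_def by blast
  \<comment> \<open>Both families are extended by zero to the union of their index sets.\<close>
  define k where "k J = (if J \<in> F then g J else 0) + (if J \<in> G then h J else 0)" for J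
  have "(\<Sum>J\<in>F \<union> G. k J) = a + b"
    unfolding k_def sum.distrib F(1) G(1) using F(2) G(2)
    by (intro arg_cong2[where f = "(+)"] sum.mono_neutral_cong_right) auto
  moreover have "k J \<in> J" if "J \<in> F \<union> G" for J
  proof -
    have "is_ideal J" using that F(3) G(3) ideals by blast
    then show ?thesis using F(4) G(4) unfolding k_def is_ideal_iff by auto
  qed
  ultimately show "a + b \<in> ideal_sum \<J>"
    unfolding ideal_sum_def using F(2,3) G(2,3)
    by (intro CollectI exI[of _ "F \<union> G"] exI[of _ k]) auto
next
  fix a r assume "a \<in> ideal_sum \<J>"
  then obtain F g where F: "a = (\<Sum>J\<in>F. g J)" "finite F" "F \<subseteq> \<J>" "\<forall>J\<in>F. g J \<in> J"
    unfolding ideal_sum_def by blast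
  then have "\<forall>J\<in>F. r * g J \<in> J"
    using ideals unfolding is_ideal_iff by blast
  then show "r * a \<in> ideal_sum \<J>"
    unfolding ideal_sum_def using F
    by (intro CollectI exI[of _ F] exI[of _ "\<lambda>J. r * g J"]) (auto simp: sum_distrib_left)
qed

section \<open>Power substitution and power-closed ideals\<close>

text \<open>
  The defining sum runs over the support of \<open>f\<close>, which varies with \<open>f\<close>. Allowing any finite
  superset makes it possible to compare the sums of two polynomials term by term.
\<close>

lemma cpoly_subst_superset:
  assumes "finite A" and "Poly_Mapping.keys f \<subseteq> A"
  shows "cpoly_subst \<sigma> f =
    (\<Sum>m\<in>A. Const (Poly_Mapping.lookup f m) * (\<Prod>j\<in>UNIV. \<sigma> j ^ Poly_Mapping.lookup m j))"
  unfolding cpoly_subst_def using assms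
  by (intro sum.mono_neutral_left) (auto simp: in_keys_iff Const_def)

lemma cpoly_subst_add:
  fixes f g :: "'d::finite cpoly"
  shows "cpoly_subst \<sigma> (f + g) = cpoly_subst \<sigma> f + cpoly_subst \<sigma> g"
proof -
  let ?A = "Poly_Mapping.keys f \<union> Poly_Mapping.keys g"
  have "(Const (Poly_Mapping.lookup (f + g) m) :: 'd cpoly) =
      Const (Poly_Mapping.lookup f m) + Const (Poly_Mapping.lookup g m)" for m
    by (simp add: Const_def lookup_add single_add)
  moreover have "Poly_Mapping.keys (f + g) \<subseteq> ?A"
    by (rule Poly_Mapping.keys_add)
  ultimately show ?thesis
    by (simp add: cpoly_subst_superset[of ?A] distrib_right sum.distrib)
qed

lemma power_subst_sum: "power_subst i (\<Sum>x\<in>A. g x) = (\<Sum>x\<in>A. power_subst i (g x))"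
proof -
  have "cpoly_subst \<sigma> 0 = 0" for \<sigma> :: "'d::finite \<Rightarrow> 'd cpoly"
    by (simp add: cpoly_subst_def)
  then show ?thesis
    unfolding power_subst_def
    by (induction A rule: infinite_finite_induct) (auto simp: cpoly_subst_add)
qed

lemma power_closed_Inter:
  assumes "\<And>I. I \<in> \<I> \<Longrightarrow> power_closed I"
  shows "power_closed (\<Inter>\<I>)"
  using assms unfolding power_closed_def by blast

lemma power_closed_ideal_sum:
  assumes "\<And>J. J \<in> \<J> \<Longrightarrow> power_closed J"
  shows "power_closed (ideal_sum \<J>)"
  unfolding power_closed_def
proof (intro ballI allI impI)
  fix f i assume "f \<in> ideal_sum \<J>" and "1 \<le> (i::nat)"
  then obtain F g where F: "f = (\<Sum>J\<in>F. g J)" "finite F" "F \<subseteq> \<J>" "\<forall>J\<in>F. g J \<in> J"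
    unfolding ideal_sum_def by blast
  have "\<forall>J\<in>F. power_subst i (g J) \<in> J"
    using F assms \<open>1 \<le> i\<close> unfolding power_closed_def by blast
  then show "power_subst i f \<in> ideal_sum \<J>"
    unfolding ideal_sum_def using F
    by (intro CollectI exI[of _ F] exI[of _ "\<lambda>J. power_subst i (g J)"]) (auto simp: power_subst_sum)
qed

section \<open>The power-interior as the largest power-closed ideal\<close>

lemma is_ideal_power_interior: "is_ideal (power_interior I)"
  unfolding power_interior_def by (rule is_ideal_ideal_sum) blast

lemma power_closed_power_interior: "power_closed (power_interior I)"
  unfolding power_interior_def by (rule power_closed_ideal_sum) blast

lemma power_interior_subset:
  assumes "is_ideal I"
  shows "power_interior I \<subseteq> I"
  unfolding power_interior_def using assms by (rule ideal_sum_least) blast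

text \<open>
  The universal property from which the laws of an interior operator follow: the members of the
  defining family are contained in their sum, and the sum does not leave \<open>I\<close>.
\<close>

lemma subset_power_interior_iff:
  assumes "is_ideal I" and "is_ideal K" and "power_closed K"
  shows "K \<subseteq> power_interior I \<longleftrightarrow> K \<subseteq> I"
proof
  assume "K \<subseteq> I"
  then show "K \<subseteq> power_interior I"
    unfolding power_interior_def using assms by (intro ideal_sum_upper) blast
qed (use power_interior_subset[OF assms(1)] in blast)

lemma power_interior_mono:
  assumes "is_ideal I" and "is_ideal J" and "J \<subseteq> I"
  shows "power_interior J \<subseteq> power_interior I"
  using assms power_interior_subset[of J]
  by (simp add: subset_power_interior_iff is_ideal_power_interior power_closed_power_interior)

lemma power_interior_eq_self:
  assumes "is_ideal I" and "power_closed I"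
  shows "power_interior I = I"
  using assms by (simp add: subset_antisym power_interior_subset subset_power_interior_iff)

lemma power_interior_Inter:
  assumes ideals: "\<And>I. I \<in> \<I> \<Longrightarrow> is_ideal I"
  shows "power_interior (\<Inter>\<I>) = (\<Inter>I\<in>\<I>. power_interior I)"
proof (rule subset_antisym)
  show "power_interior (\<Inter>\<I>) \<subseteq> (\<Inter>I\<in>\<I>. power_interior I)"
    using ideals by (intro INT_greatest power_interior_mono is_ideal_Inter) auto
next
  have "is_ideal (\<Inter>I\<in>\<I>. power_interior I)" "power_closed (\<Inter>I\<in>\<I>. power_interior I)"
    by (auto intro!: is_ideal_Inter power_closed_Inter is_ideal_power_interior
        power_closed_power_interior)
  moreover have "(\<Inter>I\<in>\<I>. power_interior I) \<subseteq> \<Inter>\<I>"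
    using power_interior_subset ideals by blast
  ultimately show "(\<Inter>I\<in>\<I>. power_interior I) \<subseteq> power_interior (\<Inter>\<I>)"
    using is_ideal_Inter[OF ideals] by (simp add: subset_power_interior_iff)
qed

theorem proposition2p8:
  shows "(\<forall>I :: 'd::finite cpoly set. is_ideal I \<longrightarrow>
            is_ideal (power_interior I) \<and> power_closed (power_interior I)) \<and>
         (\<forall>I :: 'd cpoly set. is_ideal I \<longrightarrow> power_interior I \<subseteq> I) \<and>
         (\<forall>I J :: 'd cpoly set. is_ideal I \<longrightarrow> is_ideal J \<longrightarrow> J \<subseteq> I \<longrightarrow>
            power_interior J \<subseteq> power_interior I) \<and>
         (\<forall>I :: 'd cpoly set. is_ideal I \<longrightarrow>
            power_interior (power_interior I) = power_interior I) \<and>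
         (\<forall>\<I> :: 'd cpoly set set. (\<forall>I\<in>\<I>. is_ideal I) \<longrightarrow>
            power_interior (\<Inter>I\<in>\<I>. I) = (\<Inter>I\<in>\<I>. power_interior I))"
proof (intro conjI allI impI)
  fix \<I> :: "'d cpoly set set"
  assume "\<forall>I\<in>\<I>. is_ideal I"
  then show "power_interior (\<Inter>I\<in>\<I>. I) = (\<Inter>I\<in>\<I>. power_interior I)"
    by (simp add: power_interior_Inter)
qed (simp_all add: is_ideal_power_interior power_closed_power_interior power_interior_subset
    power_interior_mono power_interior_eq_self)

end
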